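(* Let $A$ be a finite totally ordered set. The elements $e_\gamma\in\mathbb{Z}\mathrm{Styl}(A)$, one for each $\gamma\in\Gamma(A)$, form a complete system of primitive orthogonal idempotents of $\mathbb{Z}\mathrm{Styl}(A)$. Precisely: (1) $e_\gamma^2=e_\gamma$ and $e_\gamma e_\delta=0$ for all $\gamma,\delta\in\Gamma(A)$ with $\delta\neq\gamma$; (2) $\sum_{\gamma\in\Gamma(A)}e_\gamma=1$; (3) for every $\gamma\in\Gamma(A)$, the idempotent $e_\gamma$ cannot be written as $e_\gamma=x+y$ with $x$ and $y$ nonzero orthogonal idempotents in $\mathbb{Z}\mathrm{Styl}(A)$.
   Context: $A$ is a finite totally ordered set, whose elements are called letters, and $A^*$ is the free monoid on $A$. A column on $A$ is a subset of $A$ (also viewed as the word in $A^*$ that is the strictly decreasing product of its elements); $\Gamma(A)$ is the set of columns. Left action of $A^*$ on $\Gamma(A)$: for a letter $a$ and a column $\gamma$, if $a>y$ for all $y\in\gamma$, then $a\cdot\gamma=\gamma\cup\{a\}$; otherwise $a\cdot\gamma=(\gamma\setminus\{y\})\cup\{a\}$, where $y$ is the smallest element of $\gamma$ with $y\ge a$. This extends to words by $(uv)\cdot\gamma=u\cdot(v\cdot\gamma)$. The stylic monoid $\mathrm{Styl}(A)$ is the monoid (under composition) of the functions $\mu_w:\Gamma(A)\to\Gamma(A)$, $\gamma\mapsto w\cdot\gamma$, for $w\in A^*$; $\mathbb{Z}\mathrm{Styl}(A)$ is its monoid algebra over $\mathbb{Z}$. A letter or word is identified with its image $\mu_w$ when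 computing in this algebra. For $\gamma\in\Gamma(A)$, $$e_\gamma=\prod^{\nearrow}_{a\in A\setminus\gamma}(1-a)\ \prod^{\searrow}_{a\in\gamma}a\ \in\mathbb{Z}\mathrm{Styl}(A),$$ where the first product is taken (from left to right) in increasing order of letters and the second in decreasing order. Idempotents $x,y$ are orthogonal if $xy=yx=0$. *)

theory Defs
  imports "HOL-Algebra.Algebra" "HOL-Library.Poly_Mapping"
begin

section \<open>Integral monoid algebras\<close>

text \<open>
  The elements of the monoid algebra of \<open>M\<close> over the integers are the finitely supported integer
  functions on \<open>carrier M\<close>; the product is the bilinear extension of the product of \<open>M\<close>.
\<close>

definition int_monoid_algebra :: "('m, 'b) monoid_scheme \<Rightarrow> ('m \<Rightarrow>\<^sub>0 int) ring" where
  "int_monoid_algebra M =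
     \<lparr>carrier = {f. Poly_Mapping.keys f \<subseteq> carrier M},
      monoid.mult = (\<lambda>f g. frag_extend (\<lambda>x. frag_extend (\<lambda>y. frag_of (x \<otimes>\<^bsub>M\<^esub> y)) g) f),
      monoid.one = frag_of \<one>\<^bsub>M\<^esub>,
      ring.zero = 0,
      ring.add = (+)\<rparr>"

lemma int_monoid_algebra_simps:
  "carrier (int_monoid_algebra M) = {f. Poly_Mapping.keys f \<subseteq> carrier M}"
  "f \<otimes>\<^bsub>int_monoid_algebra M\<^esub> g =
     frag_extend (\<lambda>x. frag_extend (\<lambda>y. frag_of (x \<otimes>\<^bsub>M\<^esub> y)) g) f"
  "\<one>\<^bsub>int_monoid_algebra M\<^esub> = frag_of \<one>\<^bsub>M\<^esub>"
  "\<zero>\<^bsub>int_monoid_algebra M\<^esub> = 0"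
  "f \<oplus>\<^bsub>int_monoid_algebra M\<^esub> g = f + g"
  by (simp_all add: int_monoid_algebra_def)

lemma int_monoid_algebra_mult_eq_sum:
  "f \<otimes>\<^bsub>int_monoid_algebra M\<^esub> g =
     (\<Sum>x\<in>Poly_Mapping.keys f. \<Sum>y\<in>Poly_Mapping.keys g.
        Poly_Mapping.single (x \<otimes>\<^bsub>M\<^esub> y) (Poly_Mapping.lookup f x * Poly_Mapping.lookup g y))"
proof -
  have "frag_cmul c (frag_cmul d (frag_of z)) = Poly_Mapping.single z (c * d)" for c d and z :: 'a
    by (rule poly_mapping_eqI) (simp add: lookup_single when_def)
  then show ?thesis
    unfolding int_monoid_algebra_simps frag_extend_def frag_cmul_sum by simp
qed

lemma frag_extend_add_fun:
  "frag_extend (\<lambda>x. b x + c x) f = frag_extend b f + frag_extend c f"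
  by (simp add: frag_extend_def frag_cmul_distrib2 sum.distrib)

lemma frag_cmul_diff_right: "frag_cmul k (a - b) = frag_cmul k a - frag_cmul k b"
  by (rule poly_mapping_eqI) (simp add: lookup_minus right_diff_distrib)

lemma frag_extend_diff_fun:
  "frag_extend (\<lambda>x. b x - c x) f = frag_extend b f - frag_extend c f"
  by (simp add: frag_extend_def frag_cmul_diff_right sum_subtractf)

lemma frag_extend_zero_fun: "frag_extend (\<lambda>x. 0) f = 0"
  by (simp add: frag_extend_def)

lemmas frag_extend_linear =
  frag_extend_add frag_extend_diff frag_extend_add_fun frag_extend_diff_fun frag_extend_zero_fun

lemma ring_int_monoid_algebra:
  assumes "monoid M"
  shows "ring (int_monoid_algebra M)"
proof -
  interpret M: monoid M by (rule assms)
  let ?R = "int_monoid_algebra M"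
  let ?m = "\<lambda>f g. frag_extend (\<lambda>x. frag_extend (\<lambda>y. frag_of (x \<otimes>\<^bsub>M\<^esub> y)) g) f"
  have closed: "Poly_Mapping.keys (?m f g) \<subseteq> carrier M"
    if f: "Poly_Mapping.keys f \<subseteq> carrier M" and g: "Poly_Mapping.keys g \<subseteq> carrier M" for f g
  proof -
    have 1: "Poly_Mapping.keys (frag_extend (\<lambda>y. frag_of (x \<otimes>\<^bsub>M\<^esub> y)) g) \<subseteq> carrier M"
      if "x \<in> carrier M" for x
      by (rule order_trans[OF keys_frag_extend]) (use g that in \<open>auto simp: keys_frag_of\<close>)
    show ?thesis
      by (rule order_trans[OF keys_frag_extend]) (use f 1 in blast)
  qed
  have assoc: "?m (?m f g) h = ?m f (?m g h)"
    if f: "Poly_Mapping.keys f \<subseteq> carrier M" and g: "Poly_Mapping.keys g \<subseteq> carrier M"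
      and h: "Poly_Mapping.keys h \<subseteq> carrier M" for f g h
    using f
  proof (induction rule: frag_induction)
    case zero
    then show ?case by simp
  next
    case (one x)
    from g show ?case
    proof (induction rule: frag_induction)
      case zero
      then show ?case by (simp add: frag_extend_linear)
    next
      case (one y)
      from h show ?case
      proof (induction rule: frag_induction)
        case (one z)
        then show ?case
          using \<open>x \<in> carrier M\<close> \<open>y \<in> carrier M\<close> by (simp add: M.m_assoc)
      qed (simp_all add: frag_extend_linear)
    qed (simp_all add: frag_extend_linear)
  next
    case (diff a b)
    then show ?case by (simp add: frag_extend_linear)
  qed
  have l_one: "?m (frag_of \<one>\<^bsub>M\<^esub>) f = f" if "Poly_Mapping.keys f \<subseteq> carrier M" for f
    using that by (induction rule: frag_induction) (simp_all add: frag_extend_linear)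
  have r_one: "?m f (frag_of \<one>\<^bsub>M\<^esub>) = f" if "Poly_Mapping.keys f \<subseteq> carrier M" for f
    using that by (induction rule: frag_induction) (simp_all add: frag_extend_linear)
  have "abelian_group ?R"
  proof (rule abelian_groupI)
    fix f
    assume "f \<in> carrier ?R"
    then show "\<exists>g\<in>carrier ?R. g \<oplus>\<^bsub>?R\<^esub> f = \<zero>\<^bsub>?R\<^esub>"
      by (intro bexI[of _ "- f"]) (auto simp: int_monoid_algebra_simps)
  qed (use Poly_Mapping.keys_add in \<open>fastforce simp: int_monoid_algebra_simps add_ac\<close>)+
  moreover have "monoid ?R"
    by (rule monoidI)
       (auto simp: int_monoid_algebra_simps keys_frag_of assoc l_one[simplified] r_one[simplified]
         dest: subsetD[OF closed])
  ultimately show ?thesis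
    by (rule ringI) (simp_all add: int_monoid_algebra_simps frag_extend_linear)
qed


section \<open>Primitive orthogonal idempotents\<close>

definition idempotent_elem :: "('r, 'b) ring_scheme \<Rightarrow> 'r \<Rightarrow> bool" where
  "idempotent_elem R x \<longleftrightarrow> x \<in> carrier R \<and> x \<otimes>\<^bsub>R\<^esub> x = x"

definition orthogonal_elems :: "('r, 'b) ring_scheme \<Rightarrow> 'r \<Rightarrow> 'r \<Rightarrow> bool" where
  "orthogonal_elems R x y \<longleftrightarrow> x \<otimes>\<^bsub>R\<^esub> y = \<zero>\<^bsub>R\<^esub> \<and> y \<otimes>\<^bsub>R\<^esub> x = \<zero>\<^bsub>R\<^esub>"


section \<open>The stylic monoid\<close>

text \<open>Throughout, the alphabet is a finite (possibly empty) set \<open>A\<close> of a linearly ordered type.\<close>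

definition columns :: "'a set \<Rightarrow> 'a set set" where
  "columns A = Pow A"

definition letter_act :: "'a::linorder \<Rightarrow> 'a set \<Rightarrow> 'a set" where
  "letter_act a \<gamma> =
     (if \<forall>y\<in>\<gamma>. y < a then insert a \<gamma>
      else insert a (\<gamma> - {Min {y \<in> \<gamma>. a \<le> y}}))"

text \<open>Left action: the last letter of a word acts first.\<close>

definition word_act :: "'a::linorder list \<Rightarrow> 'a set \<Rightarrow> 'a set" where
  "word_act w \<gamma> = foldr letter_act w \<gamma>"

lemma word_act_append: "word_act (u @ v) \<gamma> = word_act u (word_act v \<gamma>)"
  by (simp add: word_act_def)

lemma letter_act_columns: "a \<in> A \<Longrightarrow> \<gamma> \<in> columns A \<Longrightarrow> letter_act a \<gamma> \<in> columns A"
  by (auto simp: columns_def letter_act_def)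

lemma word_act_columns: "w \<in> lists A \<Longrightarrow> \<gamma> \<in> columns A \<Longrightarrow> word_act w \<gamma> \<in> columns A"
  unfolding word_act_def by (induction w) (auto intro: letter_act_columns)

text \<open>
  Functions on \<open>columns A\<close> are represented as extensional functions, so that two words are
  identified exactly when they act in the same way on all columns.
\<close>

definition styl_map :: "'a::linorder set \<Rightarrow> 'a list \<Rightarrow> ('a set \<Rightarrow> 'a set)" where
  "styl_map A w = (\<lambda>\<gamma>\<in>columns A. word_act w \<gamma>)"

definition stylic_monoid :: "'a::linorder set \<Rightarrow> ('a set \<Rightarrow> 'a set) monoid" where
  "stylic_monoid A =
     \<lparr>carrier = styl_map A ` lists A,
      monoid.mult = compose (columns A),
      monoid.one = (\<lambda>\<gamma>\<in>columns A. \<gamma>)\<rparr>"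

lemma styl_map_append:
  assumes "v \<in> lists A"
  shows "styl_map A (u @ v) = styl_map A u \<otimes>\<^bsub>stylic_monoid A\<^esub> styl_map A v"
  using word_act_columns[OF assms]
  by (auto simp: styl_map_def stylic_monoid_def compose_def word_act_append fun_eq_iff)

lemma styl_map_Nil: "styl_map A [] = \<one>\<^bsub>stylic_monoid A\<^esub>"
  by (simp add: styl_map_def stylic_monoid_def word_act_def)

lemma carrier_stylic_monoid: "carrier (stylic_monoid A) = styl_map A ` lists A"
  by (simp add: stylic_monoid_def)

lemma monoid_stylic_monoid: "monoid (stylic_monoid A)"
proof (rule monoidI)
  show "\<one>\<^bsub>stylic_monoid A\<^esub> \<in> carrier (stylic_monoid A)"
    unfolding styl_map_Nil[symmetric] carrier_stylic_monoid by blast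
next
  fix f g
  assume "f \<in> carrier (stylic_monoid A)" "g \<in> carrier (stylic_monoid A)"
  then obtain u v where uv: "u \<in> lists A" "v \<in> lists A" "f = styl_map A u" "g = styl_map A v"
    by (auto simp: carrier_stylic_monoid)
  then have "f \<otimes>\<^bsub>stylic_monoid A\<^esub> g = styl_map A (u @ v)"
    by (simp add: styl_map_append)
  moreover have "u @ v \<in> lists A"
    using uv by simp
  ultimately show "f \<otimes>\<^bsub>stylic_monoid A\<^esub> g \<in> carrier (stylic_monoid A)"
    unfolding carrier_stylic_monoid by blast
next
  fix f g h
  assume "f \<in> carrier (stylic_monoid A)" "g \<in> carrier (stylic_monoid A)"
    "h \<in> carrier (stylic_monoid A)"
  then obtain u v w where uvw: "v \<in> lists A" "w \<in> lists A"
    "f = styl_map A u" "g = styl_map A v" "h = styl_map A w"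
    by (auto simp: carrier_stylic_monoid)
  moreover from uvw have "v @ w \<in> lists A"
    by simp
  ultimately show "f \<otimes>\<^bsub>stylic_monoid A\<^esub> g \<otimes>\<^bsub>stylic_monoid A\<^esub> h =
      f \<otimes>\<^bsub>stylic_monoid A\<^esub> (g \<otimes>\<^bsub>stylic_monoid A\<^esub> h)"
    by (metis styl_map_append append_assoc)
next
  fix f
  assume "f \<in> carrier (stylic_monoid A)"
  then obtain u where u: "u \<in> lists A" "f = styl_map A u"
    by (auto simp: carrier_stylic_monoid)
  show "\<one>\<^bsub>stylic_monoid A\<^esub> \<otimes>\<^bsub>stylic_monoid A\<^esub> f = f"
    using styl_map_append[OF u(1), of "[]"] u by (simp add: styl_map_Nil)
  show "f \<otimes>\<^bsub>stylic_monoid A\<^esub> \<one>\<^bsub>stylic_monoid A\<^esub> = f"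
    using styl_map_append[of "[]" A u] u by (simp add: styl_map_Nil)
qed

definition styl_algebra :: "'a::linorder set \<Rightarrow> (('a set \<Rightarrow> 'a set) \<Rightarrow>\<^sub>0 int) ring" where
  "styl_algebra A = int_monoid_algebra (stylic_monoid A)"

lemma ring_styl_algebra: "ring (styl_algebra A)"
  unfolding styl_algebra_def by (intro ring_int_monoid_algebra monoid_stylic_monoid)

definition styl_letter :: "'a::linorder set \<Rightarrow> 'a \<Rightarrow> (('a set \<Rightarrow> 'a set) \<Rightarrow>\<^sub>0 int)" where
  "styl_letter A a = frag_of (styl_map A [a])"

definition ordered_prod :: "('r, 'b) monoid_scheme \<Rightarrow> 'r list \<Rightarrow> 'r" where
  "ordered_prod R xs = foldr (\<otimes>\<^bsub>R\<^esub>) xs \<one>\<^bsub>R\<^esub>"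

definition styl_idem :: "'a::linorder set \<Rightarrow> 'a set \<Rightarrow> (('a set \<Rightarrow> 'a set) \<Rightarrow>\<^sub>0 int)" where
  "styl_idem A \<gamma> =
     ordered_prod (styl_algebra A)
       (map (\<lambda>a. \<one>\<^bsub>styl_algebra A\<^esub> \<ominus>\<^bsub>styl_algebra A\<^esub> styl_letter A a)
            (sorted_list_of_set (A - \<gamma>)))
     \<otimes>\<^bsub>styl_algebra A\<^esub>
     ordered_prod (styl_algebra A) (map (styl_letter A) (rev (sorted_list_of_set \<gamma>)))"

lemma styl_letter_closed: "a \<in> A \<Longrightarrow> styl_letter A a \<in> carrier (styl_algebra A)"
  by (auto simp: styl_letter_def styl_algebra_def int_monoid_algebra_simps keys_frag_of
      carrier_stylic_monoid)

lemma (in monoid) ordered_prod_closed: "set xs \<subseteq> carrier G \<Longrightarrow> ordered_prod G xs \<in> carrier G"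
  unfolding ordered_prod_def by (induction xs) auto

lemma styl_idem_closed:
  assumes "finite A" "\<gamma> \<in> columns A"
  shows "styl_idem A \<gamma> \<in> carrier (styl_algebra A)"
proof -
  interpret R: ring "styl_algebra A" by (rule ring_styl_algebra)
  from assms have "\<gamma> \<subseteq> A" "finite \<gamma>"
    by (auto simp: columns_def intro: finite_subset)
  with assms show ?thesis
    unfolding styl_idem_def
    by (intro R.m_closed R.ordered_prod_closed) (auto intro!: R.minus_closed styl_letter_closed)
qed

end

theory Submission
  imports Defs
begin

text \<open>
  Orthogonality and completeness come from one relation. If \<open>a\<close> is the least letter of \<open>A\<close>, then the
  defining product of \<open>e\<^sub>\<gamma>\<close> has \<open>a\<close> as its last factor when \<open>a \<in> \<gamma>\<close> and \<open>1 - a\<close> as its first factor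
  otherwise, so \<open>e\<^sub>\<gamma>\<close> is \<open>e' a\<close> or \<open>(1 - a) e'\<close>, where \<open>e'\<close> is the element of the same kind over the
  remaining letters. Once \<open>a\<close> has acted on a column, \<open>a\<close> belongs to the column; a larger letter never
  removes it, and a letter fixes every column that contains it. Hence \<open>a z a = z a\<close> for every \<open>z\<close> in
  the subring generated by letters \<open>\<ge> a\<close>, that is, \<open>(1 - a) z a = 0\<close>. With this, a product of two such
  elements reduces to the product of the two elements over the remaining letters
  (\<open>peeled_idem_mult\<close>), and in the sum over all \<open>\<gamma>\<close> the two kinds contribute \<open>a\<close> and \<open>1 - a\<close>
  (\<open>sum_peeled_idem\<close>).

  For primitivity, order columns by a rank that a letter raises whenever it moves a column. Summing
  over all columns gives a rank on the monoid such that \<open>u m\<close> is either \<open>m\<close> or of larger rank than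
  \<open>m\<close>. So left multiplication by an element \<open>f\<close> of the algebra is triangular in the basis of monoid
  elements, and each of its diagonal entries, the coefficient of \<open>m\<close> in \<open>f m\<close>, is a ring
  homomorphism in \<open>f\<close> to the integers. An element with zero diagonal acts nilpotently, so an idempotent
  with zero diagonal vanishes (\<open>idempotent_eq_zero\<close>). The entry of \<open>e\<^sub>\<gamma>\<close> at \<open>m\<close> is \<open>1\<close> if \<open>\<gamma>\<close> is the
  set of letters that fix \<open>m\<close>, and \<open>0\<close> otherwise. Since the diagonal entry at \<open>m\<close> depends only on this
  set of letters, it is one and the same character at all \<open>m\<close> where \<open>e\<^sub>\<gamma>\<close> has entry \<open>1\<close>. If
  \<open>e\<^sub>\<gamma> = x + y\<close> with idempotents \<open>x\<close> and \<open>y\<close>, that character sends one of them to \<open>0\<close>; all the other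
  diagonal entries of both are \<open>0\<close> as well, so this summand is zero.
\<close>
section \<open>Peeling off the least letter\<close>

text \<open>
  For an increasing list of letters this is the product defining \<open>e\<^sub>\<gamma>\<close>, read from its two outer ends
  inwards: the least letter sits at one of the ends. This form makes induction on the alphabet
  possible (see \<open>ordered_prods_eq_peeled_idem\<close>).
\<close>
primrec peeled_idem :: "('r, 'b) ring_scheme \<Rightarrow> ('i \<Rightarrow> 'r) \<Rightarrow> 'i set \<Rightarrow> 'i list \<Rightarrow> 'r" where
  "peeled_idem R x \<gamma> [] = \<one>\<^bsub>R\<^esub>"
| "peeled_idem R x \<gamma> (a # as) =
     (if a \<in> \<gamma> then peeled_idem R x \<gamma> as \<otimes>\<^bsub>R\<^esub> x a
      else (\<one>\<^bsub>R\<^esub> \<ominus>\<^bsub>R\<^esub> x a) \<otimes>\<^bsub>R\<^esub> peeled_idem R x \<gamma> as)"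

lemma peeled_idem_cong:
  "\<gamma> \<inter> set as = \<delta> \<inter> set as \<Longrightarrow> peeled_idem R x \<gamma> as = peeled_idem R x \<delta> as"
proof (induction as)
  case (Cons a as)
  then have "peeled_idem R x \<gamma> as = peeled_idem R x \<delta> as" "a \<in> \<gamma> \<longleftrightarrow> a \<in> \<delta>"
    by (auto simp: set_eq_iff)
  then show ?case by simp
qed simp

context ring
begin

lemma peeled_idem_closed:
  "x ` set as \<subseteq> carrier R \<Longrightarrow> peeled_idem R x \<gamma> as \<in> carrier R"
  by (induction as) auto

lemma ordered_prod_snoc:
  assumes "set xs \<subseteq> carrier R" "y \<in> carrier R"
  shows "ordered_prod R (xs @ [y]) = ordered_prod R xs \<otimes> y"
  using assms
proof (induction xs)
  case (Cons z xs)
  then show ?case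
    using ordered_prod_closed[of xs] by (simp add: ordered_prod_def m_assoc)
qed (simp add: ordered_prod_def)

lemma ordered_prods_eq_peeled_idem:
  assumes "x ` set as \<subseteq> carrier R"
  shows "ordered_prod R (map (\<lambda>a. \<one> \<ominus> x a) (filter (\<lambda>a. a \<notin> \<gamma>) as)) \<otimes>
           ordered_prod R (map x (rev (filter (\<lambda>a. a \<in> \<gamma>) as))) = peeled_idem R x \<gamma> as"
  using assms
proof (induction as)
  case Nil
  then show ?case by (simp add: ordered_prod_def)
next
  case (Cons a as)
  let ?p = "ordered_prod R (map (\<lambda>a. \<one> \<ominus> x a) (filter (\<lambda>a. a \<notin> \<gamma>) as))"
  let ?q = "ordered_prod R (map x (rev (filter (\<lambda>a. a \<in> \<gamma>) as)))"
  have cl: "?p \<in> carrier R" "?q \<in> carrier R" "x a \<in> carrier R"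
    using Cons.prems by (auto intro!: ordered_prod_closed minus_closed simp: image_subset_iff)
  have IH: "?p \<otimes> ?q = peeled_idem R x \<gamma> as"
    using Cons by simp
  show ?case
  proof (cases "a \<in> \<gamma>")
    case True
    have "ordered_prod R (map x (rev (filter (\<lambda>a. a \<in> \<gamma>) (a # as)))) = ?q \<otimes> x a"
      using True Cons.prems by (simp, subst ordered_prod_snoc) auto
    then show ?thesis
      using True cl IH by (simp add: m_assoc[symmetric])
  next
    case False
    then have "ordered_prod R (map (\<lambda>a. \<one> \<ominus> x a) (filter (\<lambda>a. a \<notin> \<gamma>) (a # as))) =
        (\<one> \<ominus> x a) \<otimes> ?p"
      by (simp add: ordered_prod_def)
    then show ?thesis
      using False cl IH by (simp add: m_assoc)
  qed
qed

lemma diff_left_mult: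
  assumes "u \<in> carrier R" "v \<in> carrier R" "z \<in> carrier R"
  shows "(u \<ominus> v) \<otimes> z = u \<otimes> z \<ominus> v \<otimes> z"
  using assms by (simp add: minus_eq l_distr l_minus)

lemma diff_right_mult:
  assumes "u \<in> carrier R" "v \<in> carrier R" "z \<in> carrier R"
  shows "z \<otimes> (u \<ominus> v) = z \<otimes> u \<ominus> z \<otimes> v"
  using assms by (simp add: minus_eq r_distr r_minus)

end

text \<open>
  These relations hold for the letters of the stylic monoid, and more generally for the generators of
  Kiselman's semigroup taken in reversed order.
\<close>
locale left_absorbing_family = ring R for R (structure) +
  fixes x :: "'i::linorder \<Rightarrow> 'a" and I :: "'i set"
  assumes x_closed: "a \<in> I \<Longrightarrow> x a \<in> carrier R"
    and x_idem: "a \<in> I \<Longrightarrow> x a \<otimes> x a = x a"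
    and x_absorb: "a \<in> I \<Longrightarrow> b \<in> I \<Longrightarrow> a < b \<Longrightarrow> x a \<otimes> (x b \<otimes> x a) = x b \<otimes> x a"
begin

lemma peeled_closed: "set as \<subseteq> I \<Longrightarrow> peeled_idem R x \<gamma> as \<in> carrier R"
  by (rule peeled_idem_closed) (auto intro: x_closed)

text \<open>
  Elements \<open>z\<close> with \<open>a z a = z a\<close> are closed under products, because the \<open>a\<close> that is needed between the
  two factors may be created out of the one on the right and deleted again afterwards.
\<close>
lemma absorb_mult:
  assumes "a \<in> I" "y \<in> carrier R" "z \<in> carrier R"
    and "x a \<otimes> (y \<otimes> x a) = y \<otimes> x a" "x a \<otimes> (z \<otimes> x a) = z \<otimes> x a"
  shows "x a \<otimes> ((y \<otimes> z) \<otimes> x a) = (y \<otimes> z) \<otimes> x a"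
proof -
  note cl = x_closed[OF assms(1)] assms(2,3)
  have "x a \<otimes> ((y \<otimes> z) \<otimes> x a) = x a \<otimes> (y \<otimes> (x a \<otimes> (z \<otimes> x a)))"
    using cl assms(5) by (simp add: m_assoc)
  also have "\<dots> = (x a \<otimes> (y \<otimes> x a)) \<otimes> (z \<otimes> x a)"
    using cl by (simp add: m_assoc)
  also have "\<dots> = y \<otimes> (x a \<otimes> (z \<otimes> x a))"
    using cl assms(4) by (simp add: m_assoc)
  finally show ?thesis
    using cl assms(5) by (simp add: m_assoc)
qed

lemma absorb_peeled_idem:
  assumes "a \<in> I" "set as \<subseteq> I" "\<forall>b\<in>set as. a < b"
  shows "x a \<otimes> (peeled_idem R x \<gamma> as \<otimes> x a) = peeled_idem R x \<gamma> as \<otimes> x a"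
  using assms(2,3)
proof (induction as)
  case Nil
  then show ?case using assms(1) by (simp add: x_closed x_idem)
next
  case (Cons b as)
  have cl: "x a \<in> carrier R" "x b \<in> carrier R" "peeled_idem R x \<gamma> as \<in> carrier R"
    using Cons.prems assms(1) by (auto intro: x_closed peeled_closed)
  have b: "x a \<otimes> (x b \<otimes> x a) = x b \<otimes> x a"
    using Cons.prems assms(1) by (intro x_absorb) auto
  have b': "x a \<otimes> ((\<one> \<ominus> x b) \<otimes> x a) = (\<one> \<ominus> x b) \<otimes> x a"
    using cl b x_idem[OF assms(1)] by (simp add: diff_left_mult diff_right_mult)
  have IH: "x a \<otimes> (peeled_idem R x \<gamma> as \<otimes> x a) = peeled_idem R x \<gamma> as \<otimes> x a"
    using Cons by simp
  show ?case
    using cl b b' IH assms(1) by (auto intro!: absorb_mult)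
qed

text \<open>
  Write the two factors over the least letter \<open>a\<close>, with inner parts \<open>e\<close> and \<open>f\<close>:
  \<open>(e a)(f a) = e f a\<close> and \<open>((1 - a) e)((1 - a) f) = (1 - a) e f\<close> by absorption, while
  \<open>(e a)((1 - a) f)\<close> vanishes since \<open>a\<close> is idempotent and \<open>((1 - a) e)(f a)\<close> vanishes by absorption.
\<close>
lemma peeled_idem_mult:
  assumes "sorted_wrt (<) as" "set as \<subseteq> I"
  shows "peeled_idem R x \<gamma> as \<otimes> peeled_idem R x \<delta> as =
           (if \<gamma> \<inter> set as = \<delta> \<inter> set as then peeled_idem R x \<gamma> as else \<zero>)"
  using assms
proof (induction as)
  case Nil
  then show ?case by simp
next
  case (Cons a as)
  define e where "e = peeled_idem R x \<gamma> as"
  define f where "f = peeled_idem R x \<delta> as"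
  have a: "a \<in> I" and as: "\<forall>b\<in>set as. a < b" "set as \<subseteq> I"
    using Cons.prems by auto
  have cl: "x a \<in> carrier R" "e \<in> carrier R" "f \<in> carrier R"
    using a as by (auto intro: x_closed peeled_closed simp: e_def f_def)
  have ef: "e \<otimes> f = (if \<gamma> \<inter> set as = \<delta> \<inter> set as then e else \<zero>)"
    using Cons unfolding e_def f_def by simp
  have absorb: "x a \<otimes> (e \<otimes> x a) = e \<otimes> x a" "x a \<otimes> (f \<otimes> x a) = f \<otimes> x a"
    using a as unfolding e_def f_def by (auto intro!: absorb_peeled_idem)
  have kill: "(\<one> \<ominus> x a) \<otimes> (y \<otimes> x a) = \<zero>"
    if "y \<in> carrier R" "x a \<otimes> (y \<otimes> x a) = y \<otimes> x a" for y
    using cl that by (simp add: diff_left_mult)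
  have a_notin: "a \<notin> set as" using as by auto
  show ?case
  proof (cases "a \<in> \<gamma>"; cases "a \<in> \<delta>")
    assume "a \<in> \<gamma>" "a \<in> \<delta>"
    moreover have "(e \<otimes> x a) \<otimes> (f \<otimes> x a) = (e \<otimes> f) \<otimes> x a"
      using cl absorb by (simp add: m_assoc)
    ultimately show ?thesis
      using a_notin cl ef by (auto simp flip: e_def f_def)
  next
    assume "a \<in> \<gamma>" "a \<notin> \<delta>"
    moreover have "(e \<otimes> x a) \<otimes> ((\<one> \<ominus> x a) \<otimes> f) = e \<otimes> ((x a \<otimes> (\<one> \<ominus> x a)) \<otimes> f)"
      using cl by (simp add: m_assoc)
    moreover have "x a \<otimes> (\<one> \<ominus> x a) = \<zero>"
      using cl x_idem[OF a] by (simp add: diff_right_mult)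
    ultimately show ?thesis
      using cl by (auto simp flip: e_def f_def)
  next
    assume "a \<notin> \<gamma>" "a \<in> \<delta>"
    moreover have "((\<one> \<ominus> x a) \<otimes> e) \<otimes> (f \<otimes> x a) = (\<one> \<ominus> x a) \<otimes> ((e \<otimes> f) \<otimes> x a)"
      using cl by (simp add: m_assoc)
    moreover have "\<dots> = \<zero>"
      using cl absorb by (intro kill absorb_mult a m_closed) auto
    ultimately show ?thesis
      using cl by (auto simp flip: e_def f_def)
  next
    assume na: "a \<notin> \<gamma>" "a \<notin> \<delta>"
    \<comment> \<open>The inner \<open>1 - a\<close> can be dropped: the term with the inner \<open>a\<close> contains \<open>(1 - a) e a = 0\<close>.\<close>
    have "((\<one> \<ominus> x a) \<otimes> e) \<otimes> ((\<one> \<ominus> x a) \<otimes> f) =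
        (\<one> \<ominus> x a) \<otimes> (e \<otimes> f) \<ominus> ((\<one> \<ominus> x a) \<otimes> (e \<otimes> x a)) \<otimes> f"
      using cl by (simp add: m_assoc diff_left_mult[of \<one> "x a" f] diff_right_mult)
    also have "\<dots> = (\<one> \<ominus> x a) \<otimes> (e \<otimes> f)"
      using cl kill[OF cl(2) absorb(1)] by (simp add: minus_eq)
    finally show ?thesis
      using na a_notin cl ef by (auto simp flip: e_def f_def)
  qed
qed

text \<open>
  Pairing \<open>\<gamma>\<close> with \<open>insert a \<gamma>\<close>, the sum over subsets of \<open>a # as\<close> is \<open>S a + (1 - a) S\<close>, where \<open>S\<close> is
  the sum for \<open>as\<close>; the induction hypothesis is \<open>S = 1\<close>.
\<close>
lemma sum_peeled_idem:
  assumes "distinct as" "set as \<subseteq> I"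
  shows "(\<Oplus>\<gamma>\<in>Pow (set as). peeled_idem R x \<gamma> as) = \<one>"
  using assms
proof (induction as)
  case Nil
  then show ?case by simp
next
  case (Cons a as)
  let ?e = "\<lambda>\<gamma>. peeled_idem R x \<gamma> as"
  have cl: "x a \<in> carrier R" "?e \<gamma> \<in> carrier R" for \<gamma>
    using Cons.prems by (auto intro: x_closed peeled_closed)
  have a_notin: "a \<notin> set as" using Cons.prems by simp
  have inj: "inj_on (insert a) (Pow (set as))"
    using a_notin by (intro inj_onI) (metis PowD insert_ident subsetD)
  have with_a: "peeled_idem R x (insert a \<gamma>) (a # as) = ?e \<gamma> \<otimes> x a"
    if "\<gamma> \<in> Pow (set as)" for \<gamma>
    using a_notin by (simp add: peeled_idem_cong[of "insert a \<gamma>" as \<gamma>])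
  have without_a: "peeled_idem R x \<gamma> (a # as) = (\<one> \<ominus> x a) \<otimes> ?e \<gamma>"
    if "\<gamma> \<in> Pow (set as)" for \<gamma>
    using that a_notin by auto
  have IH: "(\<Oplus>\<gamma>\<in>Pow (set as). ?e \<gamma>) = \<one>"
    using Cons by simp
  have "(\<Oplus>\<gamma>\<in>insert a ` Pow (set as). peeled_idem R x \<gamma> (a # as)) =
      (\<Oplus>\<gamma>\<in>Pow (set as). peeled_idem R x (insert a \<gamma>) (a # as))"
    using Cons.prems by (intro finsum_reindex inj) (auto intro!: peeled_closed m_closed x_closed)
  also have "\<dots> = (\<Oplus>\<gamma>\<in>Pow (set as). ?e \<gamma> \<otimes> x a)"
    using cl with_a by (intro finsum_cong') auto
  also have "\<dots> = x a"
    using cl IH by (simp add: finsum_ldistr[symmetric])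
  finally have 1: "(\<Oplus>\<gamma>\<in>insert a ` Pow (set as). peeled_idem R x \<gamma> (a # as)) = x a" .
  have "(\<Oplus>\<gamma>\<in>Pow (set as). peeled_idem R x \<gamma> (a # as)) =
      (\<Oplus>\<gamma>\<in>Pow (set as). (\<one> \<ominus> x a) \<otimes> ?e \<gamma>)"
    using cl without_a by (intro finsum_cong') auto
  also have "\<dots> = \<one> \<ominus> x a"
    using cl IH by (simp add: finsum_rdistr[symmetric])
  finally have 2: "(\<Oplus>\<gamma>\<in>Pow (set as). peeled_idem R x \<gamma> (a # as)) = \<one> \<ominus> x a" .
  have "(\<Oplus>\<gamma>\<in>Pow (set (a # as)). peeled_idem R x \<gamma> (a # as)) =
      (\<Oplus>\<gamma>\<in>Pow (set as). peeled_idem R x \<gamma> (a # as)) \<oplus>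
      (\<Oplus>\<gamma>\<in>insert a ` Pow (set as). peeled_idem R x \<gamma> (a # as))"
    unfolding list.set Pow_insert using Cons.prems a_notin
    by (intro finsum_Un_disjoint)
      (auto intro!: peeled_closed[of "a # as"] simp del: peeled_idem.simps)
  also have "\<dots> = \<one>"
    unfolding 1 2 using cl by (simp add: minus_eq a_assoc l_neg)
  finally show ?case .
qed

end


section \<open>Characters of a monoid whose left translations increase a rank\<close>

text \<open>
  The rank makes every left multiplication upper triangular in the basis of monoid elements; in
  particular such a monoid has trivial left divisibility classes.
\<close>
locale ranked_monoid = monoid M for M (structure) +
  fixes rk :: "'a \<Rightarrow> nat"
  assumes rk_less: "u \<in> carrier M \<Longrightarrow> m \<in> carrier M \<Longrightarrow> u \<otimes> m \<noteq> m \<Longrightarrow> rk m < rk (u \<otimes> m)"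
begin

abbreviation "ZM \<equiv> int_monoid_algebra M"

text \<open>
  The coefficient of \<open>m\<close> in \<open>f m\<close>, that is, the diagonal entry at \<open>m\<close> of left multiplication by \<open>f\<close>.
\<close>
definition diag_coeff :: "'a \<Rightarrow> ('a \<Rightarrow>\<^sub>0 int) \<Rightarrow> int" where
  "diag_coeff m f = Poly_Mapping.lookup (frag_extend (\<lambda>u. frag_of (u \<otimes> m)) f) m"

lemma mult_frag_of: "f \<otimes>\<^bsub>ZM\<^esub> frag_of m = frag_extend (\<lambda>u. frag_of (u \<otimes> m)) f"
  by (simp add: int_monoid_algebra_simps)

text \<open>
  If \<open>v\<close> moves \<open>m\<close>, then the rank has strictly increased and \<open>u\<close> cannot lead back to \<open>m\<close>.
\<close>
lemma mult_fixes_iff: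
  assumes "u \<in> carrier M" "v \<in> carrier M" "m \<in> carrier M"
  shows "(u \<otimes> v) \<otimes> m = m \<longleftrightarrow> u \<otimes> m = m \<and> v \<otimes> m = m"
proof
  assume uv: "(u \<otimes> v) \<otimes> m = m"
  have "v \<otimes> m = m"
  proof (rule ccontr)
    assume *: "v \<otimes> m \<noteq> m"
    then have "rk m < rk (v \<otimes> m)"
      using assms by (intro rk_less)
    also have "\<dots> \<le> rk (u \<otimes> (v \<otimes> m))"
      using rk_less[of u "v \<otimes> m"] assms by (cases "u \<otimes> (v \<otimes> m) = v \<otimes> m") auto
    finally show False
      using uv assms by (simp add: m_assoc)
  qed
  with uv assms show "u \<otimes> m = m \<and> v \<otimes> m = m"
    by (simp add: m_assoc)
qed (use assms in \<open>simp add: m_assoc\<close>)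

lemma diag_coeff_frag_of: "diag_coeff m (frag_of u) = (if u \<otimes> m = m then 1 else 0)"
  by (simp add: diag_coeff_def)

lemma diag_coeff_linear:
  "diag_coeff m 0 = 0"
  "diag_coeff m (f + g) = diag_coeff m f + diag_coeff m g"
  "diag_coeff m (f - g) = diag_coeff m f - diag_coeff m g"
  by (simp_all add: diag_coeff_def frag_extend_add frag_extend_diff lookup_add lookup_minus)

text \<open>
  By bilinearity it suffices to take monoid elements, for which this is \<open>mult_fixes_iff\<close>: diagonal
  entries of triangular matrices multiply.
\<close>
lemma diag_coeff_mult:
  assumes "m \<in> carrier M" "f \<in> carrier ZM" "g \<in> carrier ZM"
  shows "diag_coeff m (f \<otimes>\<^bsub>ZM\<^esub> g) = diag_coeff m f * diag_coeff m g"
proof -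
  have f: "Poly_Mapping.keys f \<subseteq> carrier M" and g: "Poly_Mapping.keys g \<subseteq> carrier M"
    using assms by (auto simp: int_monoid_algebra_simps)
  from f show ?thesis
  proof (induction rule: frag_induction)
    case zero
    then show ?case by (simp add: int_monoid_algebra_simps diag_coeff_linear)
  next
    case (one u)
    from g show ?case
    proof (induction rule: frag_induction)
      case zero
      then show ?case
        by (simp add: int_monoid_algebra_simps diag_coeff_linear)
    next
      case (one v)
      then show ?case
        using \<open>u \<in> carrier M\<close> assms(1)
        by (simp add: int_monoid_algebra_simps diag_coeff_frag_of mult_fixes_iff)
    next
      case (diff a b)
      then show ?case
        by (simp add: int_monoid_algebra_simps diag_coeff_linear frag_extend_diff right_diff_distrib)
    qed
  next
    case (diff a b)
    then show ?case
      by (simp add: int_monoid_algebra_simps diag_coeff_linear frag_extend_diff left_diff_distrib)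
  qed
qed

lemma diag_coeff_cong:
  assumes "f \<in> carrier ZM" "\<And>u. u \<in> carrier M \<Longrightarrow> u \<otimes> m = m \<longleftrightarrow> u \<otimes> n = n"
  shows "diag_coeff m f = diag_coeff n f"
proof -
  have "Poly_Mapping.keys f \<subseteq> carrier M"
    using assms by (auto simp: int_monoid_algebra_simps)
  then show ?thesis
    by (induction rule: frag_induction) (auto simp: diag_coeff_linear diag_coeff_frag_of assms(2))
qed

text \<open>
  Strict triangularity. In \<open>f m\<close> every basis element other than \<open>m\<close> has larger rank than \<open>m\<close>, and \<open>m\<close>
  itself does not occur because its coefficient is the diagonal entry of \<open>f\<close>.
\<close>
lemma mult_raises_rank:
  assumes f: "f \<in> carrier ZM" "\<And>m. m \<in> carrier M \<Longrightarrow> diag_coeff m f = 0"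
    and g: "Poly_Mapping.keys g \<subseteq> {m \<in> carrier M. k \<le> rk m}"
  shows "Poly_Mapping.keys (f \<otimes>\<^bsub>ZM\<^esub> g) \<subseteq> {m \<in> carrier M. Suc k \<le> rk m}"
proof -
  interpret ZM: ring ZM by (rule ring_int_monoid_algebra) (rule monoid_axioms)
  from g show ?thesis
  proof (induction rule: frag_induction)
    case zero
    then show ?case by (simp add: int_monoid_algebra_simps frag_extend_zero_fun)
  next
    case (one m)
    then have m: "m \<in> carrier M" "k \<le> rk m" by auto
    have "n \<in> carrier M \<and> Suc k \<le> rk n" if n: "n \<in> Poly_Mapping.keys (f \<otimes>\<^bsub>ZM\<^esub> frag_of m)" for n
    proof -
      have "n \<in> (\<Union>u\<in>Poly_Mapping.keys f. Poly_Mapping.keys (frag_of (u \<otimes> m)))"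
        using n unfolding mult_frag_of by (rule subsetD[OF keys_frag_extend, rotated])
      then obtain u where u: "u \<in> Poly_Mapping.keys f" "n = u \<otimes> m"
        by (auto simp: keys_frag_of)
      have "u \<in> carrier M"
        using u f(1) by (auto simp: int_monoid_algebra_simps)
      moreover have "n \<noteq> m"
        using n f(2)[OF m(1)] by (auto simp: mult_frag_of diag_coeff_def in_keys_iff)
      ultimately show ?thesis
        using rk_less[of u m] u m by auto
    qed
    then show ?case by blast
  next
    case (diff a b)
    then show ?case
      using keys_diff[of "f \<otimes>\<^bsub>ZM\<^esub> a" "f \<otimes>\<^bsub>ZM\<^esub> b"]
      by (auto simp: int_monoid_algebra_simps frag_extend_linear)
  qed
qed

text \<open>
  Since \<open>f = f f\<close>, left multiplication by \<open>f\<close> pushes the support of \<open>f\<close> itself above every rank.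
\<close>
lemma idempotent_eq_zero:
  assumes "idempotent_elem ZM f" "\<And>m. m \<in> carrier M \<Longrightarrow> diag_coeff m f = 0"
  shows "f = 0"
proof -
  have f: "f \<in> carrier ZM" "f \<otimes>\<^bsub>ZM\<^esub> f = f"
    using assms(1) by (auto simp: idempotent_elem_def)
  have high: "Poly_Mapping.keys f \<subseteq> {m \<in> carrier M. k \<le> rk m}" for k
  proof (induction k)
    case 0
    then show ?case using f(1) by (auto simp: int_monoid_algebra_simps)
  next
    case (Suc k)
    from mult_raises_rank[OF f(1) assms(2) this] show ?case
      by (simp only: f(2))
  qed
  have "m \<notin> Poly_Mapping.keys f" for m
    using high[of "Suc (rk m)"] by auto
  then have "Poly_Mapping.keys f = {}" by blast
  then show ?thesis by simp
qed

text \<open>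
  Diagonal entries of idempotents are \<open>0\<close> or \<open>1\<close>. If neither summand were zero, each would have an
  entry \<open>1\<close>, at \<open>m\<close> and at \<open>n\<close> say; there \<open>e\<close> has entry \<open>1\<close> too, so \<open>m\<close> and \<open>n\<close> have the same fixers and
  define the same character, which would then take the value \<open>1\<close> on both summands and \<open>2\<close> on \<open>e\<close>.
\<close>
lemma summand_zero_if_same_fixers:
  assumes e: "e \<in> carrier ZM"
    and range: "\<And>m. m \<in> carrier M \<Longrightarrow> diag_coeff m e \<in> {0, 1}"
    and fixers: "\<And>m n u. m \<in> carrier M \<Longrightarrow> n \<in> carrier M \<Longrightarrow> diag_coeff m e = 1 \<Longrightarrow>
        diag_coeff n e = 1 \<Longrightarrow> u \<in> carrier M \<Longrightarrow> u \<otimes> m = m \<longleftrightarrow> u \<otimes> n = n"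
    and x: "idempotent_elem ZM x" and y: "idempotent_elem ZM y"
    and xy: "e = x \<oplus>\<^bsub>ZM\<^esub> y"
  shows "x = 0 \<or> y = 0"
proof -
  have cl: "x \<in> carrier ZM" "y \<in> carrier ZM"
    using x y by (auto simp: idempotent_elem_def)
  have zero_one: "diag_coeff m f = 0 \<or> diag_coeff m f = 1"
    if "idempotent_elem ZM f" "m \<in> carrier M" for f m
    using diag_coeff_mult[of m f f] that by (auto simp: idempotent_elem_def)
  have sum: "diag_coeff m e = diag_coeff m x + diag_coeff m y" for m
    unfolding xy by (simp add: int_monoid_algebra_simps diag_coeff_linear)
  show ?thesis
  proof (rule ccontr)
    assume "\<not> (x = 0 \<or> y = 0)"
    then obtain m n where mn: "m \<in> carrier M" "n \<in> carrier M"
        "diag_coeff m x \<noteq> 0" "diag_coeff n y \<noteq> 0"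
      using idempotent_eq_zero x y by blast
    have m1: "diag_coeff m e = 1" "diag_coeff m x = 1" "diag_coeff m y = 0"
      using mn range[OF mn(1)] zero_one[OF x mn(1)] zero_one[OF y mn(1)] sum[of m] by auto
    have n1: "diag_coeff n e = 1" "diag_coeff n y = 1"
      using mn range[OF mn(2)] zero_one[OF x mn(2)] zero_one[OF y mn(2)] sum[of n] by auto
    have "diag_coeff m y = diag_coeff n y"
      by (rule diag_coeff_cong[OF cl(2)]) (rule fixers[OF mn(1,2) m1(1) n1(1)])
    with m1 n1 show False by simp
  qed
qed

end


section \<open>The action on columns\<close>

lemma letter_act_id:
  assumes "finite \<gamma>" "a \<in> \<gamma>"
  shows "letter_act a \<gamma> = \<gamma>"
proof -
  have "Min {y \<in> \<gamma>. a \<le> y} = a"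
    using assms by (intro Min_eqI) auto
  then show ?thesis
    using assms by (auto simp: letter_act_def)
qed

lemma mem_letter_act: "a \<in> letter_act a \<gamma>"
  by (simp add: letter_act_def)

text \<open>
  The action of \<open>b\<close> can only remove an element \<open>\<ge> b\<close>.
\<close>
lemma mem_letter_act_greater:
  assumes "finite \<gamma>" "a \<in> \<gamma>" "a < b"
  shows "a \<in> letter_act b \<gamma>"
proof (cases "\<forall>y\<in>\<gamma>. y < b")
  case False
  then have "Min {y \<in> \<gamma>. b \<le> y} \<in> {y \<in> \<gamma>. b \<le> y}"
    using assms(1) by (intro Min_in) (auto simp: not_less)
  then have "a \<noteq> Min {y \<in> \<gamma>. b \<le> y}"
    using assms(3) by (metis (mono_tags, lifting) leD mem_Collect_eq)
  then show ?thesis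
    using assms(2) False by (simp only: letter_act_def if_False) blast
qed (use assms in \<open>simp add: letter_act_def\<close>)

text \<open>
  The weight of a letter is positive and decreases with the letter. So inserting a letter raises the
  rank, and so does replacing a letter by a smaller one.
\<close>
definition column_rank :: "'a::linorder set \<Rightarrow> 'a set \<Rightarrow> nat" where
  "column_rank A \<gamma> = (\<Sum>y\<in>\<gamma>. card {z \<in> A. y \<le> z})"

lemma letter_act_raises_rank:
  assumes "finite A" "\<gamma> \<in> columns A" "a \<in> A" "letter_act a \<gamma> \<noteq> \<gamma>"
  shows "column_rank A \<gamma> < column_rank A (letter_act a \<gamma>)"
proof -
  have fin: "finite \<gamma>" "\<gamma> \<subseteq> A"
    using assms by (auto simp: columns_def intro: finite_subset)
  have a: "a \<notin> \<gamma>"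
    using letter_act_id fin assms(4) by blast
  have pos: "card {z \<in> A. a \<le> z} > 0"
    using assms by (auto simp: card_gt_0_iff)
  show ?thesis
  proof (cases "\<forall>y\<in>\<gamma>. y < a")
    case True
    then show ?thesis
      using fin a pos by (simp add: letter_act_def column_rank_def)
  next
    case False
    define y where "y = Min {y \<in> \<gamma>. a \<le> y}"
    have "y \<in> {y \<in> \<gamma>. a \<le> y}"
      unfolding y_def using fin False by (intro Min_in) (auto simp: not_less)
    then have y: "y \<in> \<gamma>" "a < y"
      using a by (auto simp: order_less_le)
    have "card {z \<in> A. y \<le> z} < card {z \<in> A. a \<le> z}"
    proof (intro psubset_card_mono psubsetI)
      show "{z \<in> A. y \<le> z} \<noteq> {z \<in> A. a \<le> z}"
        using assms(3) y by (metis (mono_tags, lifting) leD mem_Collect_eq order_refl)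
    qed (use assms(1) y in auto)
    moreover have "letter_act a \<gamma> = insert a (\<gamma> - {y})"
      using False by (auto simp: letter_act_def y_def)
    moreover have "column_rank A \<gamma> = card {z \<in> A. y \<le> z} + column_rank A (\<gamma> - {y})"
      using fin y by (simp add: column_rank_def sum.remove)
    ultimately show ?thesis
      using fin a by (simp add: column_rank_def)
  qed
qed

lemma word_act_raises_rank:
  assumes "finite A" "\<gamma> \<in> columns A" "w \<in> lists A"
  shows "word_act w \<gamma> = \<gamma> \<or> column_rank A \<gamma> < column_rank A (word_act w \<gamma>)"
  using assms(3)
proof (induction w)
  case Nil
  then show ?case by (simp add: word_act_def)
next
  case (Cons a w)
  have "word_act (a # w) \<gamma> = letter_act a (word_act w \<gamma>)"
    by (simp add: word_act_def)
  moreover have "letter_act a (word_act w \<gamma>) = word_act w \<gamma> \<or>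
      column_rank A (word_act w \<gamma>) < column_rank A (letter_act a (word_act w \<gamma>))"
    using letter_act_raises_rank[OF assms(1) word_act_columns[OF Cons.hyps(2) assms(2)] Cons.hyps(1)]
    by blast
  ultimately show ?case
    using Cons.IH by (metis less_trans)
qed


section \<open>The stylic monoid and its algebra\<close>

definition map_rank :: "'a::linorder set \<Rightarrow> ('a set \<Rightarrow> 'a set) \<Rightarrow> nat" where
  "map_rank A m = (\<Sum>\<gamma>\<in>columns A. column_rank A (m \<gamma>))"

lemma ranked_stylic_monoid:
  fixes A :: "'a::linorder set"
  assumes "finite A"
  shows "ranked_monoid (stylic_monoid A) (map_rank A)"
proof (intro ranked_monoid.intro ranked_monoid_axioms.intro monoid_stylic_monoid)
  fix u m
  assume u: "u \<in> carrier (stylic_monoid A)" and m: "m \<in> carrier (stylic_monoid A)"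
    and ne: "u \<otimes>\<^bsub>stylic_monoid A\<^esub> m \<noteq> m"
  obtain v w where v: "v \<in> lists A" "u = styl_map A v" and w: "w \<in> lists A" "m = styl_map A w"
    using u m unfolding carrier_stylic_monoid by (elim imageE)
  have um: "u \<otimes>\<^bsub>stylic_monoid A\<^esub> m = styl_map A (v @ w)"
    unfolding v(2) w(2) using w(1) by (rule styl_map_append[symmetric])
  have step: "word_act (v @ w) \<gamma> = word_act w \<gamma> \<or>
      column_rank A (word_act w \<gamma>) < column_rank A (word_act (v @ w) \<gamma>)"
    if "\<gamma> \<in> columns A" for \<gamma>
    unfolding word_act_append
    using assms that v w by (intro word_act_raises_rank word_act_columns)
  have "\<exists>\<gamma>\<in>columns A. word_act (v @ w) \<gamma> \<noteq> word_act w \<gamma>"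
  proof (rule ccontr)
    assume "\<not> ?thesis"
    then have "styl_map A (v @ w) = styl_map A w"
      unfolding styl_map_def by (intro restrict_ext) blast
    with ne um w(2) show False
      by simp
  qed
  then obtain \<gamma> where \<gamma>: "\<gamma> \<in> columns A" "word_act (v @ w) \<gamma> \<noteq> word_act w \<gamma>"
    by blast
  have "finite (columns A)"
    using assms by (simp add: columns_def)
  then have "(\<Sum>\<gamma>\<in>columns A. column_rank A (word_act w \<gamma>)) <
      (\<Sum>\<gamma>\<in>columns A. column_rank A (word_act (v @ w) \<gamma>))"
    by (rule sum_strict_mono_ex1) (use step \<gamma> in force)+
  then have "map_rank A m < map_rank A (styl_map A (v @ w))"
    unfolding w(2) by (simp add: map_rank_def styl_map_def)
  then show "map_rank A m < map_rank A (u \<otimes>\<^bsub>stylic_monoid A\<^esub> m)"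
    by (simp only: um)
qed

text \<open>
  Because of this, the character attached to \<open>m\<close> depends only on the set of letters that fix \<open>m\<close>.
\<close>
lemma styl_map_fixes_iff:
  assumes "finite A" "m \<in> carrier (stylic_monoid A)" "w \<in> lists A"
  shows "styl_map A w \<otimes>\<^bsub>stylic_monoid A\<^esub> m = m \<longleftrightarrow>
           (\<forall>a\<in>set w. styl_map A [a] \<otimes>\<^bsub>stylic_monoid A\<^esub> m = m)"
proof -
  interpret ranked_monoid "stylic_monoid A" "map_rank A"
    by (rule ranked_stylic_monoid) (rule assms)
  from assms(3) show ?thesis
  proof (induction w)
    case Nil
    then show ?case using assms by (simp add: styl_map_Nil)
  next
    case (Cons a w)
    have "styl_map A [a] \<in> carrier (stylic_monoid A)" "styl_map A w \<in> carrier (stylic_monoid A)"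
      using Cons.hyps by (auto simp: carrier_stylic_monoid)
    then show ?case
      using Cons assms(2) styl_map_append[of w A "[a]"] by (simp add: mult_fixes_iff)
  qed
qed

lemma styl_letter_mult:
  assumes "b \<in> A"
  shows "styl_letter A a \<otimes>\<^bsub>styl_algebra A\<^esub> styl_letter A b = frag_of (styl_map A [a, b])"
  using styl_map_append[of "[b]" A "[a]"] assms
  by (simp add: styl_letter_def styl_algebra_def int_monoid_algebra_simps)

text \<open>
  After \<open>a\<close> and then \<open>b > a\<close> have acted, \<open>a\<close> is still in the column, so acting with \<open>a\<close> once more
  changes nothing.
\<close>
lemma left_absorbing_styl_letter:
  fixes A :: "'a::linorder set"
  assumes "finite A"
  shows "left_absorbing_family (styl_algebra A) (styl_letter A) A"
proof (intro left_absorbing_family.intro left_absorbing_family_axioms.intro ring_styl_algebra)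
  fix a b assume a: "a \<in> A"
  have fin: "finite (letter_act c \<gamma>)" if "c \<in> A" "\<gamma> \<in> columns A" for c \<gamma>
    using letter_act_columns[OF that] assms by (auto simp: columns_def intro: finite_subset)
  show "styl_letter A a \<in> carrier (styl_algebra A)"
    using a by (rule styl_letter_closed)
  have "styl_map A [a, a] = styl_map A [a]"
    using a fin
    by (auto simp: styl_map_def word_act_def letter_act_id mem_letter_act intro!: restrict_ext)
  then show "styl_letter A a \<otimes>\<^bsub>styl_algebra A\<^esub> styl_letter A a = styl_letter A a"
    by (simp only: styl_letter_mult[OF a]) (simp add: styl_letter_def)
  assume b: "b \<in> A" "a < b"
  have "styl_map A [a, b, a] = styl_map A [b, a]"
    unfolding styl_map_def
  proof (rule restrict_ext)
    fix \<gamma> assume \<gamma>: "\<gamma> \<in> columns A"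
    then have "letter_act a \<gamma> \<in> columns A"
      using a by (intro letter_act_columns)
    then have "finite (letter_act b (letter_act a \<gamma>))"
      using b by (intro fin)
    moreover have "a \<in> letter_act b (letter_act a \<gamma>)"
      using a b \<gamma> by (intro mem_letter_act_greater fin mem_letter_act)
    ultimately show "word_act [a, b, a] \<gamma> = word_act [b, a] \<gamma>"
      by (simp add: word_act_def letter_act_id)
  qed
  moreover have "styl_letter A a \<otimes>\<^bsub>styl_algebra A\<^esub> frag_of (styl_map A [b, a]) =
      frag_of (styl_map A [a, b, a])"
    using styl_map_append[of "[b, a]" A "[a]"] a b
    by (simp add: styl_letter_def styl_algebra_def int_monoid_algebra_simps)
  ultimately show "styl_letter A a \<otimes>\<^bsub>styl_algebra A\<^esub>
      (styl_letter A b \<otimes>\<^bsub>styl_algebra A\<^esub> styl_letter A a) =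
      styl_letter A b \<otimes>\<^bsub>styl_algebra A\<^esub> styl_letter A a"
    by (simp only: styl_letter_mult[OF a])
qed

lemma styl_idem_eq_peeled_idem:
  assumes "finite A" "\<gamma> \<in> columns A"
  shows "styl_idem A \<gamma> =
           peeled_idem (styl_algebra A) (styl_letter A) \<gamma> (sorted_list_of_set A)"
proof -
  interpret R: ring "styl_algebra A" by (rule ring_styl_algebra)
  have filter: "sorted_list_of_set {a \<in> A. P a} = filter P (sorted_list_of_set A)" for P
    using assms(1)
    by (intro sorted_distinct_set_unique) (simp_all add: sorted_wrt_filter)
  have "sorted_list_of_set (A - \<gamma>) = filter (\<lambda>a. a \<notin> \<gamma>) (sorted_list_of_set A)"
    unfolding set_diff_eq by (rule filter)
  moreover have "{a \<in> A. a \<in> \<gamma>} = \<gamma>"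
    using assms(2) by (auto simp: columns_def)
  then have "sorted_list_of_set \<gamma> = filter (\<lambda>a. a \<in> \<gamma>) (sorted_list_of_set A)"
    using filter[of "\<lambda>a. a \<in> \<gamma>"] by simp
  moreover have "styl_letter A ` set (sorted_list_of_set A) \<subseteq> carrier (styl_algebra A)"
    using assms(1) by (auto intro: styl_letter_closed)
  ultimately show ?thesis
    unfolding styl_idem_def by (simp only: R.ordered_prods_eq_peeled_idem)
qed

text \<open>
  The character at \<open>m\<close> sends a letter to \<open>1\<close> if it fixes \<open>m\<close> and to \<open>0\<close> if not. The product defining
  \<open>e\<^sub>\<gamma>\<close> is therefore sent to \<open>1\<close> exactly when the fixing letters are those in \<open>\<gamma>\<close>.
\<close>
lemma diag_coeff_styl_idem:
  assumes "finite A" "\<gamma> \<in> columns A" "m \<in> carrier (stylic_monoid A)"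
  shows "ranked_monoid.diag_coeff (stylic_monoid A) m (styl_idem A \<gamma>) =
           (if \<gamma> = {a \<in> A. styl_map A [a] \<otimes>\<^bsub>stylic_monoid A\<^esub> m = m} then 1 else 0)"
proof -
  interpret ranked_monoid "stylic_monoid A" "map_rank A"
    by (rule ranked_stylic_monoid) (rule assms)
  interpret R: left_absorbing_family "styl_algebra A" "styl_letter A" A
    by (rule left_absorbing_styl_letter) (rule assms)
  let ?fixes = "\<lambda>a. styl_map A [a] \<otimes>\<^bsub>stylic_monoid A\<^esub> m = m"
  let ?e = "peeled_idem (styl_algebra A) (styl_letter A) \<gamma>"
  have one: "diag_coeff m \<one>\<^bsub>styl_algebra A\<^esub> = 1"
    using assms(3) by (simp add: styl_algebra_def int_monoid_algebra_simps diag_coeff_frag_of)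
  have letter: "diag_coeff m (styl_letter A a) = (if ?fixes a then 1 else 0)" for a
    by (simp add: styl_letter_def diag_coeff_frag_of)
  have minus: "u \<ominus>\<^bsub>styl_algebra A\<^esub> v = u - v"
    if "u \<in> carrier (styl_algebra A)" "v \<in> carrier (styl_algebra A)" for u v
  proof -
    have "(u \<ominus>\<^bsub>styl_algebra A\<^esub> v) + v = u"
      using R.a_assoc[of u "\<ominus>\<^bsub>styl_algebra A\<^esub> v" v] that
      by (simp add: R.minus_eq R.l_neg) (simp add: styl_algebra_def int_monoid_algebra_simps)
    then show ?thesis by (simp add: algebra_simps)
  qed
  have "diag_coeff m (?e as) = (if \<forall>a\<in>set as. a \<in> \<gamma> \<longleftrightarrow> ?fixes a then 1 else 0)"
    if "set as \<subseteq> A" for as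
    using that
  proof (induction as)
    case (Cons a as)
    have cl: "styl_letter A a \<in> carrier (styl_algebra A)" "?e as \<in> carrier (styl_algebra A)"
      using Cons.prems by (auto intro: R.x_closed R.peeled_closed)
    note mult = diag_coeff_mult[OF assms(3), folded styl_algebra_def]
    have IH: "diag_coeff m (?e as) = (if \<forall>a\<in>set as. a \<in> \<gamma> \<longleftrightarrow> ?fixes a then 1 else 0)"
      using Cons by simp
    show ?case
    proof (cases "a \<in> \<gamma>")
      case True
      then show ?thesis
        using cl by (simp add: mult IH letter)
    next
      case False
      have "diag_coeff m (\<one>\<^bsub>styl_algebra A\<^esub> \<ominus>\<^bsub>styl_algebra A\<^esub> styl_letter A a) =
          (if ?fixes a then 0 else 1)"
        using cl by (simp add: minus diag_coeff_linear one letter)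
      then show ?thesis
        using False cl by (simp add: mult IH)
    qed
  qed (simp add: one)
  from this[of "sorted_list_of_set A"] show ?thesis
    using assms(1,2) by (auto simp: styl_idem_eq_peeled_idem columns_def)
qed

theorem theorem3p1:
  fixes A :: "'a::linorder set"
  assumes "finite A"
  shows "(\<forall>\<gamma>\<in>columns A.
            styl_idem A \<gamma> \<otimes>\<^bsub>styl_algebra A\<^esub> styl_idem A \<gamma> = styl_idem A \<gamma> \<and>
            (\<forall>\<delta>\<in>columns A. \<delta> \<noteq> \<gamma> \<longrightarrow>
              styl_idem A \<gamma> \<otimes>\<^bsub>styl_algebra A\<^esub> styl_idem A \<delta> = \<zero>\<^bsub>styl_algebra A\<^esub>)) \<and>
         (\<Oplus>\<^bsub>styl_algebra A\<^esub>\<gamma>\<in>columns A. styl_idem A \<gamma>) = \<one>\<^bsub>styl_algebra A\<^esub> \<and>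
         (\<forall>\<gamma>\<in>columns A.
            \<not> (\<exists>x y. idempotent_elem (styl_algebra A) x \<and> idempotent_elem (styl_algebra A) y \<and>
                    x \<noteq> \<zero>\<^bsub>styl_algebra A\<^esub> \<and> y \<noteq> \<zero>\<^bsub>styl_algebra A\<^esub> \<and>
                    orthogonal_elems (styl_algebra A) x y \<and>
                    styl_idem A \<gamma> = x \<oplus>\<^bsub>styl_algebra A\<^esub> y))"
proof -
  interpret M: ranked_monoid "stylic_monoid A" "map_rank A"
    by (rule ranked_stylic_monoid) (rule assms)
  interpret R: left_absorbing_family "styl_algebra A" "styl_letter A" A
    by (rule left_absorbing_styl_letter) (rule assms)
  have mult: "styl_idem A \<gamma> \<otimes>\<^bsub>styl_algebra A\<^esub> styl_idem A \<delta> =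
      (if \<gamma> = \<delta> then styl_idem A \<gamma> else \<zero>\<^bsub>styl_algebra A\<^esub>)"
    if "\<gamma> \<in> columns A" "\<delta> \<in> columns A" for \<gamma> \<delta>
  proof -
    have inter: "\<gamma> \<inter> set (sorted_list_of_set A) = \<gamma>" "\<delta> \<inter> set (sorted_list_of_set A) = \<delta>"
      using that assms by (auto simp: columns_def)
    have "sorted_wrt (<) (sorted_list_of_set A)" "set (sorted_list_of_set A) \<subseteq> A"
      using assms by simp_all
    from R.peeled_idem_mult[OF this, of \<gamma> \<delta>] show ?thesis
      unfolding inter styl_idem_eq_peeled_idem[OF assms that(1)]
        styl_idem_eq_peeled_idem[OF assms that(2)] .
  qed
  have "(\<Oplus>\<^bsub>styl_algebra A\<^esub>\<gamma>\<in>columns A. styl_idem A \<gamma>) =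
      (\<Oplus>\<^bsub>styl_algebra A\<^esub>\<gamma>\<in>Pow A.
        peeled_idem (styl_algebra A) (styl_letter A) \<gamma> (sorted_list_of_set A))"
    using assms
    by (intro R.finsum_cong')
       (auto simp: columns_def styl_idem_eq_peeled_idem intro!: R.peeled_closed)
  also have "\<dots> = \<one>\<^bsub>styl_algebra A\<^esub>"
    using R.sum_peeled_idem[of "sorted_list_of_set A"] assms by simp
  finally have sum: "(\<Oplus>\<^bsub>styl_algebra A\<^esub>\<gamma>\<in>columns A. styl_idem A \<gamma>) = \<one>\<^bsub>styl_algebra A\<^esub>" .
  have primitive: "x = \<zero>\<^bsub>styl_algebra A\<^esub> \<or> y = \<zero>\<^bsub>styl_algebra A\<^esub>"
    if \<gamma>: "\<gamma> \<in> columns A" and xy: "idempotent_elem (styl_algebra A) x"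
      "idempotent_elem (styl_algebra A) y" "styl_idem A \<gamma> = x \<oplus>\<^bsub>styl_algebra A\<^esub> y" for \<gamma> x y
  proof -
    note diag = diag_coeff_styl_idem[OF assms \<gamma>]
    have zero: "\<zero>\<^bsub>styl_algebra A\<^esub> = 0"
      by (simp add: styl_algebra_def int_monoid_algebra_simps)
    show ?thesis
      unfolding zero
    proof (rule M.summand_zero_if_same_fixers[folded styl_algebra_def, OF _ _ _ xy])
      show "styl_idem A \<gamma> \<in> carrier (styl_algebra A)"
        using assms \<gamma> by (rule styl_idem_closed)
      show "M.diag_coeff m (styl_idem A \<gamma>) \<in> {0, 1}" if "m \<in> carrier (stylic_monoid A)" for m
        using diag[OF that] by auto
      fix m n u
      assume m: "m \<in> carrier (stylic_monoid A)" and n: "n \<in> carrier (stylic_monoid A)"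
        and m1: "M.diag_coeff m (styl_idem A \<gamma>) = 1"
        and n1: "M.diag_coeff n (styl_idem A \<gamma>) = 1"
        and u: "u \<in> carrier (stylic_monoid A)"
      have "\<gamma> = {a \<in> A. styl_map A [a] \<otimes>\<^bsub>stylic_monoid A\<^esub> m = m}"
        using m1 unfolding diag[OF m] by (metis zero_neq_one)
      moreover have "\<gamma> = {a \<in> A. styl_map A [a] \<otimes>\<^bsub>stylic_monoid A\<^esub> n = n}"
        using n1 unfolding diag[OF n] by (metis zero_neq_one)
      ultimately have same: "styl_map A [a] \<otimes>\<^bsub>stylic_monoid A\<^esub> m = m \<longleftrightarrow>
          styl_map A [a] \<otimes>\<^bsub>stylic_monoid A\<^esub> n = n" if "a \<in> A" for a
        using that by blast
      obtain w where w: "w \<in> lists A" "u = styl_map A w"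
        using u unfolding carrier_stylic_monoid by (elim imageE)
      then have "a \<in> A" if "a \<in> set w" for a
        using that by auto
      then show "u \<otimes>\<^bsub>stylic_monoid A\<^esub> m = m \<longleftrightarrow> u \<otimes>\<^bsub>stylic_monoid A\<^esub> n = n"
        unfolding w(2) styl_map_fixes_iff[OF assms m w(1)] styl_map_fixes_iff[OF assms n w(1)]
        using same by blast
    qed
  qed
  show ?thesis
    using mult sum primitive by (simp, blast)
qed

end
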